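(* For every odd integer $d\geqslant 5$ and every integer $s$ with $1\leqslant s\leqslant d-3$, there is a Cayley graph $G$ with degree $d$ (i.e. $G$ is $d$-regular) such that $$\lambda'(G)=d+s<\tfrac12\,\upsilon(G),$$ where $\upsilon(G)$ is the number of vertices of $G$.
   Context: Graphs are finite, simple, connected and undirected. A Cayley graph $C_\Gamma(S)$, for a finite group $\Gamma$ and a subset $S=S^{-1}\subset\Gamma$ not containing the identity, has vertex-set $\Gamma$ and edge-set $\{xy: x^{-1}y\in S,\ x,y\in\Gamma\}$. For a non-trivial connected graph $G$, a set $F\subset E(G)$ is a restricted edge-cut if $G-F$ is disconnected and contains no isolated vertices; the restricted edge-connectivity $\lambda'(G)$ is the minimum cardinality of a restricted edge-cut of $G$ (well-defined for every connected graph of order at least $4$ other than a star). *)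

theory Defs
  imports "HOL-Algebra.Algebra"
begin

record 'v graph =
  verts :: "'v set"
  edges :: "'v set set"

definition simple_graph :: "'v graph \<Rightarrow> bool" where
  "simple_graph G \<longleftrightarrow> finite (verts G) \<and> (\<forall>e\<in>edges G. e \<subseteq> verts G \<and> card e = 2)"

definition adj :: "'v graph \<Rightarrow> ('v \<times> 'v) set" where
  "adj G = {(x, y). {x, y} \<in> edges G}"

definition connected_graph :: "'v graph \<Rightarrow> bool" where
  "connected_graph G \<longleftrightarrow> verts G \<noteq> {} \<and> (\<forall>x\<in>verts G. \<forall>y\<in>verts G. (x, y) \<in> (adj G)\<^sup>*)"

definition degree :: "'v graph \<Rightarrow> 'v \<Rightarrow> nat" where
  "degree G v = card {e \<in> edges G. v \<in> e}"

definition regular_graph :: "'v graph \<Rightarrow> nat \<Rightarrow> bool" where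
  "regular_graph G d \<longleftrightarrow> (\<forall>v\<in>verts G. degree G v = d)"

definition isolated_vertex :: "'v graph \<Rightarrow> 'v \<Rightarrow> bool" where
  "isolated_vertex G v \<longleftrightarrow> v \<in> verts G \<and> (\<forall>e\<in>edges G. v \<notin> e)"

definition delete_edges :: "'v graph \<Rightarrow> 'v set set \<Rightarrow> 'v graph" where
  "delete_edges G F = G\<lparr>edges := edges G - F\<rparr>"

definition restricted_edge_cut :: "'v graph \<Rightarrow> 'v set set \<Rightarrow> bool" where
  "restricted_edge_cut G F \<longleftrightarrow>
     F \<subseteq> edges G \<and> \<not> connected_graph (delete_edges G F) \<and>
     \<not> (\<exists>v. isolated_vertex (delete_edges G F) v)"

text \<open>
  The infimum over the natural numbers is attained whenever a restricted edge-cut exists;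
  otherwise it takes the junk value 0. So for a connected graph, a positive value always
  comes from an actual restricted edge-cut of minimum cardinality.
\<close>
definition restricted_edge_connectivity :: "'v graph \<Rightarrow> nat" where
  "restricted_edge_connectivity G = Inf {card F | F. restricted_edge_cut G F}"

definition cayley_set :: "('v, 'b) monoid_scheme \<Rightarrow> 'v set \<Rightarrow> bool" where
  "cayley_set \<Gamma> S \<longleftrightarrow>
     S \<subseteq> carrier \<Gamma> \<and> \<one>\<^bsub>\<Gamma>\<^esub> \<notin> S \<and> S = set_inv\<^bsub>\<Gamma>\<^esub> S"

definition cayley_graph :: "('v, 'b) monoid_scheme \<Rightarrow> 'v set \<Rightarrow> 'v graph" where
  "cayley_graph \<Gamma> S =
     \<lparr>verts = carrier \<Gamma>,
      edges = {{x, y} | x y. x \<in> carrier \<Gamma> \<and> y \<in> carrier \<Gamma> \<and> inv\<^bsub>\<Gamma>\<^esub> x \<otimes>\<^bsub>\<Gamma>\<^esub> y \<in> S}\<rparr>"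

definition is_cayley_graph :: "'v graph \<Rightarrow> bool" where
  "is_cayley_graph G \<longleftrightarrow>
     (\<exists>(\<Gamma> :: 'v monoid) S. group \<Gamma> \<and> finite (carrier \<Gamma>) \<and> cayley_set \<Gamma> S \<and> G = cayley_graph \<Gamma> S)"

lemma simple_graph_cayley_graph:
  assumes "group \<Gamma>" "finite (carrier \<Gamma>)" "cayley_set \<Gamma> S"
  shows "simple_graph (cayley_graph \<Gamma> S)"
proof -
  interpret group \<Gamma> by fact
  have "x \<noteq> y" if "x \<in> carrier \<Gamma>" "inv\<^bsub>\<Gamma>\<^esub> x \<otimes>\<^bsub>\<Gamma>\<^esub> y \<in> S" for x y
    using that assms(3) by (auto simp: cayley_set_def)
  then show ?thesis
    using assms(2) by (auto simp: simple_graph_def cayley_graph_def card_2_iff)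
qed

end

theory Submission
  imports Defs
begin

text \<open>
  Put \<open>m = d + s\<close>. Take a circulant graph on \<open>m\<close> vertices of the even degree \<open>d - 1\<close> and join
  \<open>2 m\<close> copies of it, called blocks, along the pattern of the complete bipartite graph
  \<open>K\<^sub>m\<^sub>,\<^sub>m\<close>: the \<open>m\<close> vertices of a block are matched with the \<open>m\<close> blocks of the other colour,
  each by one edge. The result is \<open>d\<close>-regular with \<open>2 m\<^sup>2\<close> vertices, and the \<open>m\<close> matching edges that
  leave a single block form a restricted edge-cut, so that \<open>\<lambda>'\<close> is at most \<open>m = d + s\<close>. The graph is
  a Cayley graph of the wreath product of \<open>\<int>/m\<close> with the group of order two
  (\<open>swap_wreath\<close>): the connection set of the circulant generates the first factor,
  and the involution that exchanges the two factors provides the matching edges.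

  For the lower bound, every restricted edge-cut contains the edge boundary of a vertex set
  \<open>C\<close> such that \<open>C\<close> and its complement have at least two elements each
  (\<open>restricted_edge_cut_contains_boundary\<close>), and it remains to bound the boundary of such a \<open>C\<close> by
  \<open>m\<close> from below. The circulant is dense: \<open>m \<le> 2 (d - 1)\<close>, because \<open>s \<le> d - 3\<close>. Counting the
  neighbours that a vertex can have inside a small set gives two facts
  (\<open>card_boundary_arcs_dense\<close>): a block that meets both \<open>C\<close> and its complement has at
  least \<open>d - 1 \<ge> m / 2\<close> boundary edges inside the block, and a set \<open>Y\<close> of at least two
  vertices of one block has at least \<open>m - |Y|\<close> of them.

  Hence two blocks that are split by \<open>C\<close> suffice. Suppose that at most one block is split, say of
  the first colour. If the blocks of the second colour do not all lie on one side, then every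
  unsplit block of the first colour sends a matching edge across the cut; these are at least
  \<open>m - 1\<close> edges, and the split block contributes at least one more. If all blocks of the
  second colour lie outside \<open>C\<close>, every vertex of \<open>C\<close> sends its matching edge across the cut:
  either \<open>C\<close> contains a whole block and has at least \<open>m\<close> vertices, or \<open>C\<close> is a set \<open>Y\<close> of at least two
  vertices in one block and the second fact applies. The remaining case is the complementary one.
  This is \<open>family_cut_ge\<close>, and it needs of the circulant only the two facts above; the
  construction therefore works for every finite group \<open>A\<close> with a connection set of at least
  \<open>|A| / 2\<close> elements (\<open>restricted_edge_connectivity_wreath\<close>).
\<close>

section \<open>Restricted edge-cuts and edge boundaries\<close>

definition edge_boundary :: "'v graph \<Rightarrow> 'v set \<Rightarrow> 'v set set" where
  "edge_boundary G C = {e \<in> edges G. e \<inter> C \<noteq> {} \<and> \<not> e \<subseteq> C}"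

lemma simple_graph_edgeE:
  assumes "simple_graph G" "e \<in> edges G" "x \<in> e"
  obtains y where "e = {x, y}" "x \<noteq> y" "x \<in> verts G" "y \<in> verts G"
proof -
  have "card e = 2" "e \<subseteq> verts G"
    using assms by (auto simp: simple_graph_def)
  then show thesis
    using assms(3) that by (auto simp: card_2_iff)
qed

lemma finite_edges_simple_graph: "simple_graph G \<Longrightarrow> finite (edges G)"
  by (rule finite_subset[of _ "Pow (verts G)"]) (auto simp: simple_graph_def)

text \<open>An edge leaving the set of vertices reachable from \<open>x\<close> would make its other end reachable.\<close>
lemma edge_boundary_component:
  "edge_boundary G {z \<in> verts G. (x, z) \<in> (adj G)\<^sup>*} = {}" if "simple_graph G"
proof -
  have False if e: "e \<in> edges G" and u: "u \<in> e" "u \<in> verts G" "(x, u) \<in> (adj G)\<^sup>*"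
    and nsub: "\<not> e \<subseteq> {z \<in> verts G. (x, z) \<in> (adj G)\<^sup>*}" for e u
  proof -
    obtain v where v: "e = {u, v}" "v \<in> verts G"
      using simple_graph_edgeE[OF \<open>simple_graph G\<close> e u(1)] by blast
    then have "(u, v) \<in> adj G"
      using e by (simp add: adj_def)
    then have "(x, v) \<in> (adj G)\<^sup>*"
      using u(3) by simp
    then show False
      using nsub u v by auto
  qed
  then show ?thesis
    by (auto simp: edge_boundary_def)
qed

lemma disconnected_graph_boundaryE:
  assumes "simple_graph G" "verts G \<noteq> {}" "\<not> connected_graph G"
  obtains C where "C \<subset> verts G" "C \<noteq> {}" "edge_boundary G C = {}"
proof -
  obtain x y where xy: "x \<in> verts G" "y \<in> verts G" "(x, y) \<notin> (adj G)\<^sup>*"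
    using assms(2,3) by (auto simp: connected_graph_def)
  show thesis
    by (rule that[OF _ _ edge_boundary_component[OF assms(1), of x]]) (use xy in auto)
qed

lemma connected_graph_boundary_nonempty:
  assumes "simple_graph G" "connected_graph G" "C \<subset> verts G" "C \<noteq> {}"
  shows "edge_boundary G C \<noteq> {}"
proof
  assume no: "edge_boundary G C = {}"
  obtain x y where xy: "x \<in> C" "x \<in> verts G" "y \<in> verts G" "y \<notin> C"
    using assms(3,4) by blast
  have "(x, y) \<in> (adj G)\<^sup>*"
    using assms(2) xy by (simp add: connected_graph_def)
  then have "y \<in> C"
  proof (induction rule: rtrancl_induct)
    case (step u v)
    then have "{u, v} \<in> edges G" "{u, v} \<notin> edge_boundary G C"
      using no by (auto simp: adj_def)
    then show ?case
      using step.IH by (auto simp: edge_boundary_def)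
  qed (use xy in simp)
  then show False
    using xy by simp
qed

text \<open>
  Deleting \<open>F\<close> leaves a component \<open>C\<close> that is not everything. Only edges in \<open>F\<close> leave \<open>C\<close>, and since no vertex is isolated both \<open>C\<close> and its complement contain an edge,
  hence two vertices.
\<close>
lemma restricted_edge_cut_contains_boundary:
  assumes "simple_graph G" "verts G \<noteq> {}" "restricted_edge_cut G F"
  obtains C where "C \<subseteq> verts G" "2 \<le> card C" "2 \<le> card (verts G - C)" "edge_boundary G C \<subseteq> F"
proof -
  let ?H = "delete_edges G F"
  have H: "verts ?H = verts G" "edges ?H = edges G - F" "simple_graph ?H"
    using assms(1) by (simp_all add: delete_edges_def simple_graph_def)
  obtain C where C: "C \<subset> verts G" "C \<noteq> {}" "edge_boundary ?H C = {}"
    using disconnected_graph_boundaryE[OF H(3)] assms H by (auto simp: restricted_edge_cut_def)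
  have nbr: "\<exists>w\<in>verts G. w \<noteq> v \<and> {v, w} \<in> edges ?H" if v: "v \<in> verts G" for v
  proof -
    obtain e where e: "e \<in> edges ?H" "v \<in> e"
      using assms(3) v H(1) by (auto simp: restricted_edge_cut_def isolated_vertex_def)
    show ?thesis
      using simple_graph_edgeE[OF H(3) e] e(1) H(1) by metis
  qed
  have same_side: "v \<in> C \<longleftrightarrow> w \<in> C" if "{v, w} \<in> edges ?H" for v w
    using C(3) that by (auto simp: edge_boundary_def)
  have fin: "finite (verts G)"
    using assms(1) by (simp add: simple_graph_def)
  obtain x y where xy: "x \<in> C" "y \<in> verts G" "y \<notin> C"
    using C by blast
  have two: "2 \<le> card A"
    if A: "A \<subseteq> verts G" "v \<in> A" "\<And>w. w \<in> verts G \<Longrightarrow> {v, w} \<in> edges ?H \<Longrightarrow> w \<in> A" for A v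
  proof -
    obtain w where "w \<in> verts G" "w \<noteq> v" "{v, w} \<in> edges ?H"
      using nbr A(1,2) by blast
    then have "{v, w} \<subseteq> A" "card {v, w} = 2"
      using A by auto
    then show ?thesis
      using card_mono[OF finite_subset[OF A(1) fin]] by metis
  qed
  have "2 \<le> card C"
    by (rule two[of C x]) (use same_side[of x] xy C(1) in auto)
  moreover have "2 \<le> card (verts G - C)"
    by (rule two[of "verts G - C" y]) (use same_side[of y] xy in auto)
  moreover have "edge_boundary G C \<subseteq> F"
    using C(3) H(2) by (auto simp: edge_boundary_def)
  ultimately show thesis
    using that C(1) by blast
qed

text \<open>A vertex with a neighbour on its own side of \<open>C\<close> keeps that edge when the boundary is deleted.\<close>
lemma restricted_edge_cut_boundary:
  assumes "simple_graph G" "C \<subset> verts G" "C \<noteq> {}"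
    and nbr: "\<And>v. v \<in> verts G \<Longrightarrow> \<exists>w. {v, w} \<in> edges G \<and> (v \<in> C \<longleftrightarrow> w \<in> C)"
  shows "restricted_edge_cut G (edge_boundary G C)"
proof -
  let ?H = "delete_edges G (edge_boundary G C)"
  have H: "verts ?H = verts G" "edges ?H = edges G - edge_boundary G C" "simple_graph ?H"
    using assms(1) by (simp_all add: delete_edges_def simple_graph_def)
  have "edge_boundary ?H C = {}"
    using H(2) by (auto simp: edge_boundary_def)
  then have "\<not> connected_graph ?H"
    using connected_graph_boundary_nonempty[OF H(3)] assms(2,3) H(1) by auto
  moreover have "\<not> isolated_vertex ?H v" for v
  proof
    assume v: "isolated_vertex ?H v"
    then have "v \<in> verts G"
      using H(1) by (simp add: isolated_vertex_def)
    then obtain w where "{v, w} \<in> edges G" "v \<in> C \<longleftrightarrow> w \<in> C"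
      using nbr by blast
    then have "{v, w} \<in> edges ?H"
      using H(2) by (auto simp: edge_boundary_def)
    then show False
      using v by (auto simp: isolated_vertex_def)
  qed
  ultimately show ?thesis
    by (auto simp: restricted_edge_cut_def edge_boundary_def)
qed

text \<open>
  The lower bound is asked for every set with at least two vertices on either side. Such
  sets need not give restricted edge-cuts, but they are described by cardinalities alone,
  without mention of isolated vertices.
\<close>
lemma restricted_edge_connectivity_eqI:
  assumes G: "simple_graph G"
    and C: "C \<subset> verts G" "C \<noteq> {}"
      "\<And>v. v \<in> verts G \<Longrightarrow> \<exists>w. {v, w} \<in> edges G \<and> (v \<in> C \<longleftrightarrow> w \<in> C)"
      "card (edge_boundary G C) = m"
    and lower: "\<And>Y. Y \<subseteq> verts G \<Longrightarrow> 2 \<le> card Y \<Longrightarrow> 2 \<le> card (verts G - Y) \<Longrightarrow>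
      m \<le> card (edge_boundary G Y)"
  shows "restricted_edge_connectivity G = m"
  unfolding restricted_edge_connectivity_def
proof (rule cInf_eq_minimum)
  show "m \<in> {card F |F. restricted_edge_cut G F}"
    using restricted_edge_cut_boundary[OF G C(1-3)] C(4) by blast
next
  fix k
  assume "k \<in> {card F |F. restricted_edge_cut G F}"
  then obtain F where F: "restricted_edge_cut G F" "k = card F"
    by blast
  moreover have "verts G \<noteq> {}"
    using C(1) by blast
  ultimately obtain Y where Y: "Y \<subseteq> verts G" "2 \<le> card Y" "2 \<le> card (verts G - Y)"
    "edge_boundary G Y \<subseteq> F"
    using restricted_edge_cut_contains_boundary[OF G] by metis
  have "finite F"
    using F(1) finite_subset[OF _ finite_edges_simple_graph[OF G]]
    by (simp add: restricted_edge_cut_def)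
  then show "m \<le> k"
    using lower[OF Y(1-3)] card_mono[OF _ Y(4)] F(2) by linarith
qed

section \<open>Cayley graphs counted by arcs\<close>

text \<open>
  Each edge of the boundary is recorded once, as an ordered pair that points out of \<open>C\<close>. Unlike
  two-element sets, such pairs can be counted by their first component.
\<close>
definition boundary_arcs :: "('a, 'b) monoid_scheme \<Rightarrow> 'a set \<Rightarrow> 'a set \<Rightarrow> ('a \<times> 'a) set" where
  "boundary_arcs \<Gamma> S C =
     {(x, y). x \<in> C \<and> y \<in> carrier \<Gamma> - C \<and> inv\<^bsub>\<Gamma>\<^esub> x \<otimes>\<^bsub>\<Gamma>\<^esub> y \<in> S}"

lemma finite_boundary_arcs:
  "finite (carrier \<Gamma>) \<Longrightarrow> C \<subseteq> carrier \<Gamma> \<Longrightarrow> finite (boundary_arcs \<Gamma> S C)"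
  by (rule finite_subset[of _ "carrier \<Gamma> \<times> carrier \<Gamma>"]) (auto simp: boundary_arcs_def)

context group
begin

lemma cayley_set_inv_mem:
  assumes "cayley_set G S" "s \<in> S"
  shows "inv s \<in> S"
  using assms unfolding cayley_set_def SET_INV_def by auto

lemma cayley_adjacency_sym:
  assumes "cayley_set G S" "x \<in> carrier G" "y \<in> carrier G"
  shows "inv x \<otimes> y \<in> S \<longleftrightarrow> inv y \<otimes> x \<in> S"
proof -
  have "inv v \<otimes> u \<in> S" if "inv u \<otimes> v \<in> S" "u \<in> carrier G" "v \<in> carrier G" for u v
    using cayley_set_inv_mem[OF assms(1) that(1)] that(2,3) by (simp add: inv_mult_group)
  then show ?thesis
    using assms(2,3) by blast
qed

lemma cayley_edge_iff:
  assumes "cayley_set G S" "x \<in> carrier G" "y \<in> carrier G"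
  shows "{x, y} \<in> edges (cayley_graph G S) \<longleftrightarrow> inv x \<otimes> y \<in> S"
proof
  assume "{x, y} \<in> edges (cayley_graph G S)"
  then show "inv x \<otimes> y \<in> S"
    using cayley_adjacency_sym[OF assms] by (auto simp: cayley_graph_def doubleton_eq_iff)
next
  assume "inv x \<otimes> y \<in> S"
  then show "{x, y} \<in> edges (cayley_graph G S)"
    using assms(2,3) by (auto simp: cayley_graph_def)
qed

lemma card_edge_boundary_cayley_graph:
  assumes S: "cayley_set G S" and C: "C \<subseteq> carrier G"
  shows "card (edge_boundary (cayley_graph G S) C) = card (boundary_arcs G S C)"
proof -
  let ?h = "\<lambda>(x, y). {x, y}"
  have "?h ` boundary_arcs G S C = edge_boundary (cayley_graph G S) C"
  proof (intro equalityI subsetI)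
    fix e assume "e \<in> ?h ` boundary_arcs G S C"
    then show "e \<in> edge_boundary (cayley_graph G S) C"
      using C by (fastforce simp: boundary_arcs_def edge_boundary_def cayley_graph_def)
  next
    fix e assume e: "e \<in> edge_boundary (cayley_graph G S) C"
    then obtain x y where xy: "e = {x, y}" "x \<in> carrier G" "y \<in> carrier G" "inv x \<otimes> y \<in> S"
      by (auto simp: edge_boundary_def cayley_graph_def)
    then have "inv y \<otimes> x \<in> S"
      using cayley_adjacency_sym[OF S] by blast
    moreover have "x \<in> C \<and> y \<notin> C \<or> y \<in> C \<and> x \<notin> C"
      using e xy(1) by (auto simp: edge_boundary_def)
    ultimately have "(x, y) \<in> boundary_arcs G S C \<or> (y, x) \<in> boundary_arcs G S C"
      using xy by (auto simp: boundary_arcs_def)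
    then show "e \<in> ?h ` boundary_arcs G S C"
      using xy(1) by force
  qed
  moreover have "inj_on ?h (boundary_arcs G S C)"
    by (auto simp: inj_on_def boundary_arcs_def doubleton_eq_iff)
  ultimately show ?thesis
    using card_image by metis
qed

lemma card_boundary_arcs_Compl:
  assumes S: "cayley_set G S" and C: "C \<subseteq> carrier G"
  shows "card (boundary_arcs G S (carrier G - C)) = card (boundary_arcs G S C)"
proof -
  have "boundary_arcs G S (carrier G - C) = prod.swap ` boundary_arcs G S C"
  proof (intro equalityI subrelI)
    fix x y assume "(x, y) \<in> boundary_arcs G S (carrier G - C)"
    then have "(y, x) \<in> boundary_arcs G S C"
      using C cayley_adjacency_sym[OF S, of x y] by (auto simp: boundary_arcs_def)
    then show "(x, y) \<in> prod.swap ` boundary_arcs G S C"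
      by force
  next
    fix x y assume "(x, y) \<in> prod.swap ` boundary_arcs G S C"
    then have "(y, x) \<in> boundary_arcs G S C"
      by auto
    then show "(x, y) \<in> boundary_arcs G S (carrier G - C)"
      using C cayley_adjacency_sym[OF S, of x y] by (auto simp: boundary_arcs_def)
  qed
  then show ?thesis
    by (simp add: card_image)
qed

lemma card_out_neighbours:
  assumes "S \<subseteq> carrier G" "x \<in> carrier G"
  shows "card {y \<in> carrier G. inv x \<otimes> y \<in> S} = card S"
proof -
  have "{y \<in> carrier G. inv x \<otimes> y \<in> S} = (\<otimes>) x ` S"
  proof (intro equalityI subsetI)
    fix y assume y: "y \<in> {y \<in> carrier G. inv x \<otimes> y \<in> S}"
    then have "y = x \<otimes> (inv x \<otimes> y)"
      using assms(2) by (simp flip: m_assoc)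
    then show "y \<in> (\<otimes>) x ` S"
      using y by blast
  qed (use assms in \<open>auto simp flip: m_assoc\<close>)
  then show ?thesis
    using assms by (metis card_image inj_on_subset inj_on_cmult)
qed

lemma regular_cayley_graph:
  assumes S: "cayley_set G S"
  shows "regular_graph (cayley_graph G S) (card S)"
proof -
  have "card {e \<in> edges (cayley_graph G S). x \<in> e} = card S" if x: "x \<in> carrier G" for x
  proof -
    have "{e \<in> edges (cayley_graph G S). x \<in> e} =
        (\<lambda>y. {x, y}) ` {y \<in> carrier G. inv x \<otimes> y \<in> S}"
    proof (intro equalityI subsetI)
      fix e assume "e \<in> {e \<in> edges (cayley_graph G S). x \<in> e}"
      then obtain u v where e: "e = {u, v}" "u \<in> carrier G" "v \<in> carrier G" "inv u \<otimes> v \<in> S" "x \<in> {u, v}"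
        by (auto simp: cayley_graph_def)
      then have "inv v \<otimes> u \<in> S"
        using cayley_adjacency_sym[OF S] by blast
      then show "e \<in> (\<lambda>y. {x, y}) ` {y \<in> carrier G. inv x \<otimes> y \<in> S}"
        using e by (auto simp: insert_commute)
    next
      fix e assume "e \<in> (\<lambda>y. {x, y}) ` {y \<in> carrier G. inv x \<otimes> y \<in> S}"
      then show "e \<in> {e \<in> edges (cayley_graph G S). x \<in> e}"
        using x cayley_edge_iff[OF S x] by auto
    qed
    moreover have "inj_on (\<lambda>y. {x, y}) {y \<in> carrier G. inv x \<otimes> y \<in> S}"
      by (auto simp: inj_on_def doubleton_eq_iff)
    ultimately show ?thesis
      using card_out_neighbours[of S x] S x by (simp add: card_image cayley_set_def)
  qed
  then show ?thesis
    by (auto simp: regular_graph_def degree_def cayley_graph_def)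
qed

text \<open>
  An element of \<open>C\<close> has \<open>|S|\<close> neighbours, at most \<open>|C| - 1\<close> of which lie in \<open>C\<close>.
  The subtraction truncates to zero for large \<open>C\<close>, where the bound is trivial.
\<close>
lemma card_boundary_arcs_ge_degree:
  assumes fin: "finite (carrier G)" and S: "S \<subseteq> carrier G" "\<one> \<notin> S" and C: "C \<subseteq> carrier G"
  shows "card C * (card S + 1 - card C) \<le> card (boundary_arcs G S C)"
proof -
  have finC: "finite C"
    using C fin finite_subset by blast
  have "card S + 1 - card C \<le> card {y \<in> carrier G - C. inv x \<otimes> y \<in> S}" if x: "x \<in> C" for x
  proof -
    have "x \<in> carrier G"
      using x C by blast
    then have "{y \<in> carrier G. inv x \<otimes> y \<in> S} \<subseteq> {y \<in> carrier G - C. inv x \<otimes> y \<in> S} \<union> (C - {x})"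
      using S(2) by auto
    then have "card {y \<in> carrier G. inv x \<otimes> y \<in> S}
        \<le> card ({y \<in> carrier G - C. inv x \<otimes> y \<in> S} \<union> (C - {x}))"
      using fin finC by (intro card_mono) auto
    also have "\<dots> \<le> card {y \<in> carrier G - C. inv x \<otimes> y \<in> S} + card (C - {x})"
      by (rule card_Un_le)
    finally have "card S \<le> card {y \<in> carrier G - C. inv x \<otimes> y \<in> S} + (card C - 1)"
      using card_out_neighbours[OF S(1) \<open>x \<in> carrier G\<close>] x by simp
    moreover have "0 < card C"
      using x finC by (auto simp: card_gt_0_iff)
    ultimately show ?thesis
      by linarith
  qed
  then have "card C * (card S + 1 - card C) \<le> (\<Sum>x\<in>C. card {y \<in> carrier G - C. inv x \<otimes> y \<in> S})"
    using sum_mono[of C "\<lambda>_. card S + 1 - card C"] by simp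
  also have "\<dots> = card (SIGMA x:C. {y \<in> carrier G - C. inv x \<otimes> y \<in> S})"
    using fin finC by (intro card_SigmaI[symmetric]) auto
  also have "(SIGMA x:C. {y \<in> carrier G - C. inv x \<otimes> y \<in> S}) = boundary_arcs G S C"
    by (auto simp: boundary_arcs_def)
  finally show ?thesis .
qed

text \<open>
  The product \<open>x (|S| + 1 - x)\<close> is concave in \<open>x = |C|\<close>; over \<open>1 \<le> x \<le> |S|\<close> it is smallest at the
  ends, where it equals \<open>|S|\<close>. Likewise \<open>x + x (|S| + 1 - x)\<close> takes the value \<open>2 |S|\<close> at both ends of
  \<open>2 \<le> x \<le> |S|\<close>.
\<close>
lemma card_boundary_arcs_small:
  assumes fin: "finite (carrier G)" and S: "S \<subseteq> carrier G" "\<one> \<notin> S" and C: "C \<subseteq> carrier G"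
    and ne: "C \<noteq> {}" and le: "card C \<le> card S"
  shows "card S \<le> card (boundary_arcs G S C)"
    and "2 \<le> card C \<Longrightarrow> 2 * card S \<le> card C + card (boundary_arcs G S C)"
proof -
  obtain a where a: "card S = card C + a"
    using le_Suc_ex[OF le] by blast
  have pos: "1 \<le> card C"
    using ne finite_subset[OF C fin] by (simp add: Suc_le_eq card_gt_0_iff)
  have deg: "card C * a + card C \<le> card (boundary_arcs G S C)"
    using card_boundary_arcs_ge_degree[OF fin S C] a by simp
  have "1 * a \<le> card C * a"
    using pos by (rule mult_right_mono) simp
  then show "card S \<le> card (boundary_arcs G S C)"
    using deg a by linarith
  assume "2 \<le> card C"
  then have "2 * a \<le> card C * a"
    by (rule mult_right_mono) simp
  then show "2 * card S \<le> card C + card (boundary_arcs G S C)"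
    using deg a by linarith
qed

text \<open>
  When \<open>|G| \<le> 2 |S|\<close>, a set or its complement has at most \<open>|S|\<close> elements, and both have the same
  boundary. For the second bound and a large set \<open>C\<close>, every element of the complement has a
  neighbour in \<open>C\<close>, which already gives \<open>|G| - |C|\<close> arcs.
\<close>
lemma card_boundary_arcs_dense:
  assumes fin: "finite (carrier G)" and S: "cayley_set G S" and dense: "card (carrier G) \<le> 2 * card S"
    and C: "C \<subseteq> carrier G"
  shows "C \<noteq> {} \<Longrightarrow> C \<noteq> carrier G \<Longrightarrow> card S \<le> card (boundary_arcs G S C)"
    and "2 \<le> card C \<Longrightarrow> card (carrier G) \<le> card C + card (boundary_arcs G S C)"
proof -
  have S': "S \<subseteq> carrier G" "\<one> \<notin> S"
    using S by (auto simp: cayley_set_def)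
  let ?C' = "carrier G - C"
  have C': "?C' \<subseteq> carrier G"
    by blast
  have cC': "card (boundary_arcs G S ?C') = card (boundary_arcs G S C)"
    by (rule card_boundary_arcs_Compl[OF S C])
  have sum: "card C + card ?C' = card (carrier G)"
    using fin C by (metis card_Diff_subset card_mono finite_subset le_add_diff_inverse)
  have small: "card C \<le> card S \<or> card ?C' \<le> card S"
    using sum dense by linarith
  show "card S \<le> card (boundary_arcs G S C)" if "C \<noteq> {}" "C \<noteq> carrier G"
  proof (cases "card C \<le> card S")
    case True
    then show ?thesis
      using card_boundary_arcs_small(1)[OF fin S' C] that by blast
  next
    case False
    then show ?thesis
      using card_boundary_arcs_small(1)[OF fin S' C'] small that C cC' by auto
  qed
  show "card (carrier G) \<le> card C + card (boundary_arcs G S C)" if "2 \<le> card C"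
  proof (cases "card C \<le> card S")
    case True
    have "C \<noteq> {}"
      using that by auto
    then show ?thesis
      using card_boundary_arcs_small(2)[OF fin S' C _ True that] dense by linarith
  next
    case False
    then have "card ?C' \<le> card S"
      using small by blast
    then have "card ?C' * 1 \<le> card ?C' * (card S + 1 - card ?C')"
      by (intro mult_left_mono) auto
    then show ?thesis
      using card_boundary_arcs_ge_degree[OF fin S' C'] cC' sum by linarith
  qed
qed

end

text \<open>
  Relabelling the elements of a group by an isomorphism preserves boundaries. This lets the
  wreath product be handled in its natural coordinates and be moved to the natural numbers at the end.
\<close>
lemma card_boundary_arcs_iso:
  assumes "group \<Gamma>" "group \<Gamma>'" "\<phi> \<in> iso \<Gamma> \<Gamma>'" "S \<subseteq> carrier \<Gamma>" "C \<subseteq> carrier \<Gamma>"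
  shows "card (boundary_arcs \<Gamma>' (\<phi> ` S) (\<phi> ` C)) = card (boundary_arcs \<Gamma> S C)"
proof -
  interpret \<phi>: group_hom \<Gamma> \<Gamma>' \<phi>
    using assms by (auto simp: group_hom_def group_hom_axioms_def iso_def)
  have inj: "inj_on \<phi> (carrier \<Gamma>)" and surj: "\<phi> ` carrier \<Gamma> = carrier \<Gamma>'"
    using assms(3) by (auto simp: iso_def bij_betw_def)
  have adj: "inv\<^bsub>\<Gamma>'\<^esub> \<phi> x \<otimes>\<^bsub>\<Gamma>'\<^esub> \<phi> y \<in> \<phi> ` S \<longleftrightarrow> inv\<^bsub>\<Gamma>\<^esub> x \<otimes>\<^bsub>\<Gamma>\<^esub> y \<in> S"
    if "x \<in> carrier \<Gamma>" "y \<in> carrier \<Gamma>" for x y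
  proof -
    have "inv\<^bsub>\<Gamma>'\<^esub> \<phi> x \<otimes>\<^bsub>\<Gamma>'\<^esub> \<phi> y = \<phi> (inv\<^bsub>\<Gamma>\<^esub> x \<otimes>\<^bsub>\<Gamma>\<^esub> y)"
      using that by simp
    then show ?thesis
      by (simp only:) (rule inj_on_image_mem_iff[OF inj _ assms(4)], use that in simp)
  qed
  have mem: "\<phi> x \<in> \<phi> ` C \<longleftrightarrow> x \<in> C" if "x \<in> carrier \<Gamma>" for x
    using inj_on_image_mem_iff[OF inj that assms(5)] .
  have "boundary_arcs \<Gamma>' (\<phi> ` S) (\<phi> ` C) = map_prod \<phi> \<phi> ` boundary_arcs \<Gamma> S C"
  proof (intro equalityI subsetI)
    fix p assume p: "p \<in> boundary_arcs \<Gamma>' (\<phi> ` S) (\<phi> ` C)"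
    then obtain x y where xy: "p = (\<phi> x, \<phi> y)" "x \<in> C" "y \<in> carrier \<Gamma>"
      unfolding boundary_arcs_def by (auto simp flip: surj)
    then have "(x, y) \<in> boundary_arcs \<Gamma> S C"
      using p adj[of x y] mem[of y] assms(5) by (auto simp: boundary_arcs_def)
    then show "p \<in> map_prod \<phi> \<phi> ` boundary_arcs \<Gamma> S C"
      using xy(1) by force
  next
    fix p assume "p \<in> map_prod \<phi> \<phi> ` boundary_arcs \<Gamma> S C"
    then show "p \<in> boundary_arcs \<Gamma>' (\<phi> ` S) (\<phi> ` C)"
      using adj mem assms(5) by (auto simp: boundary_arcs_def)
  qed
  moreover have "inj_on (map_prod \<phi> \<phi>) (boundary_arcs \<Gamma> S C)"
  proof (rule inj_on_subset)
    show "inj_on (map_prod \<phi> \<phi>) (carrier \<Gamma> \<times> carrier \<Gamma>)"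
      using inj by (rule map_prod_inj_on[OF _ inj])
    show "boundary_arcs \<Gamma> S C \<subseteq> carrier \<Gamma> \<times> carrier \<Gamma>"
      using assms(5) by (auto simp: boundary_arcs_def)
  qed
  ultimately show ?thesis
    by (simp add: card_image)
qed

lemma iso_image_group:
  assumes "group \<Gamma>" "inj_on f (carrier \<Gamma>)"
  shows "group (image_group f \<Gamma>)" "f \<in> iso \<Gamma> (image_group f \<Gamma>)"
proof -
  interpret group \<Gamma>
    by fact
  show iso: "f \<in> iso \<Gamma> (image_group f \<Gamma>)"
    using assms(2) by (auto simp: iso_def hom_def bij_betw_def image_group_def)
  show "group (image_group f \<Gamma>)"
    using iso_imp_img_group[OF iso] by (simp add: image_group_def)
qed

lemma cayley_set_iso:
  assumes "group \<Gamma>" "group \<Gamma>'" "\<phi> \<in> iso \<Gamma> \<Gamma>'" "cayley_set \<Gamma> S"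
  shows "cayley_set \<Gamma>' (\<phi> ` S)"
proof -
  interpret \<phi>: group_hom \<Gamma> \<Gamma>' \<phi>
    using assms by (auto simp: group_hom_def group_hom_axioms_def iso_def)
  have S: "S \<subseteq> carrier \<Gamma>" "\<one>\<^bsub>\<Gamma>\<^esub> \<notin> S" "S = (\<lambda>s. inv\<^bsub>\<Gamma>\<^esub> s) ` S"
    using assms(4) by (auto simp: cayley_set_def SET_INV_def)
  have inj: "inj_on \<phi> (carrier \<Gamma>)"
    using assms(3) by (auto simp: iso_def bij_betw_def)
  have "\<one>\<^bsub>\<Gamma>'\<^esub> \<notin> \<phi> ` S"
    using inj_on_image_mem_iff[OF inj \<phi>.G.one_closed S(1)] S(2) by simp
  moreover have "\<phi> ` S = (\<lambda>s. inv\<^bsub>\<Gamma>'\<^esub> s) ` \<phi> ` S"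
  proof -
    have "(\<lambda>s. inv\<^bsub>\<Gamma>'\<^esub> s) ` \<phi> ` S = \<phi> ` (\<lambda>s. inv\<^bsub>\<Gamma>\<^esub> s) ` S"
      unfolding image_image by (intro image_cong refl) (use S(1) in auto)
    then show ?thesis
      using S(3) by simp
  qed
  ultimately show ?thesis
    using S(1) by (auto simp: cayley_set_def SET_INV_def)
qed

section \<open>Two families of subsets of a finite set\<close>

text \<open>
  A set of vertices of the block graph is given by two families: \<open>U b\<close> is its intersection with
  block \<open>b\<close> of the first colour and \<open>W a\<close> that with block \<open>a\<close> of the second, and vertex \<open>a\<close> of
  block \<open>b\<close> is matched with vertex \<open>b\<close> of block \<open>a\<close>. With \<open>c\<close> counting boundary edges inside a block,
  \<open>family_cut\<close> is the size of the edge boundary. The formulation is symmetric in the two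
  colours and under complements, which reduces the case analysis.
\<close>
definition family_cut :: "('a set \<Rightarrow> nat) \<Rightarrow> 'a set \<Rightarrow> ('a \<Rightarrow> 'a set) \<Rightarrow> ('a \<Rightarrow> 'a set) \<Rightarrow> nat" where
  "family_cut c A U W =
     (\<Sum>b\<in>A. c (U b)) + (\<Sum>a\<in>A. c (W a)) + card {(a, b) \<in> A \<times> A. (a \<in> U b) \<noteq> (b \<in> W a)}"

lemma family_cut_swap: "family_cut c A W U = family_cut c A U W"
proof -
  have "{(a, b) \<in> A \<times> A. (a \<in> W b) \<noteq> (b \<in> U a)} =
      prod.swap ` {(a, b) \<in> A \<times> A. (a \<in> U b) \<noteq> (b \<in> W a)}"
    by auto
  then show ?thesis
    by (simp add: family_cut_def card_image)
qed

lemma family_cut_Compl: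
  assumes compl: "\<And>Y. Y \<subseteq> A \<Longrightarrow> c (A - Y) = c Y"
    and sub: "\<And>x. x \<in> A \<Longrightarrow> U x \<subseteq> A" "\<And>x. x \<in> A \<Longrightarrow> W x \<subseteq> A"
  shows "family_cut c A (\<lambda>b. A - U b) (\<lambda>a. A - W a) = family_cut c A U W"
proof -
  have "{(a, b) \<in> A \<times> A. (a \<in> A - U b) \<noteq> (b \<in> A - W a)} = {(a, b) \<in> A \<times> A. (a \<in> U b) \<noteq> (b \<in> W a)}"
    by auto
  moreover have "(\<Sum>b\<in>A. c (A - U b)) = (\<Sum>b\<in>A. c (U b))" "(\<Sum>a\<in>A. c (A - W a)) = (\<Sum>a\<in>A. c (W a))"
    using compl sub by (auto intro!: sum.cong)
  ultimately show ?thesis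
    by (simp add: family_cut_def)
qed

text \<open>
  With the second colour outside the set, each of its elements is mismatched: the cut is at least
  the size of the set, which is \<open>|A|\<close> if it contains a whole block, and otherwise the
  set lies inside the block \<open>b\<^sub>0\<close>, whose inner boundary makes up for the missing elements.
\<close>
lemma family_cut_empty:
  assumes A: "finite A" "b\<^sub>0 \<in> A"
    and absorb: "\<And>Y. Y \<subseteq> A \<Longrightarrow> 2 \<le> card Y \<Longrightarrow> card A \<le> card Y + c Y"
    and U: "\<And>b. b \<in> A \<Longrightarrow> U b \<subseteq> A" "\<And>b. b \<in> A \<Longrightarrow> b \<noteq> b\<^sub>0 \<Longrightarrow> U b = {} \<or> U b = A"
    and W: "\<And>a. a \<in> A \<Longrightarrow> W a = {}"
    and size: "2 \<le> (\<Sum>b\<in>A. card (U b)) + (\<Sum>a\<in>A. card (W a))"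
  shows "card A \<le> family_cut c A U W"
proof -
  have "a \<in> A \<and> b \<notin> W a" if "b \<in> A" "a \<in> U b" for a b
    using U(1) W that by blast
  then have "{(a, b) \<in> A \<times> A. (a \<in> U b) \<noteq> (b \<in> W a)} = prod.swap ` (SIGMA b:A. U b)"
    using W by (force simp: image_iff)
  then have "card {(a, b) \<in> A \<times> A. (a \<in> U b) \<noteq> (b \<in> W a)} = card (SIGMA b:A. U b)"
    by (simp add: card_image)
  also have "\<dots> = (\<Sum>b\<in>A. card (U b))"
    using A(1) U(1) finite_subset by (intro card_SigmaI) blast+
  finally have cut: "family_cut c A U W \<ge> (\<Sum>b\<in>A. c (U b)) + (\<Sum>b\<in>A. card (U b))"
    by (simp add: family_cut_def)
  show ?thesis
  proof (cases "\<exists>b\<in>A. U b = A")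
    case True
    then obtain b where "b \<in> A" "U b = A"
      by blast
    then have "card A \<le> (\<Sum>b\<in>A. card (U b))"
      using member_le_sum[of b A "\<lambda>b. card (U b)"] A(1) by simp
    then show ?thesis
      using cut by linarith
  next
    case False
    have "(\<Sum>b\<in>A. card (U b)) = card (U b\<^sub>0) + (\<Sum>b\<in>A - {b\<^sub>0}. card (U b))"
      using A by (rule sum.remove)
    also have "(\<Sum>b\<in>A - {b\<^sub>0}. card (U b)) = 0"
      using U(2) False by (intro sum.neutral) auto
    finally have U0: "(\<Sum>b\<in>A. card (U b)) = card (U b\<^sub>0)"
      by simp
    moreover have "(\<Sum>a\<in>A. card (W a)) = 0"
      using W by simp
    ultimately have "card A \<le> card (U b\<^sub>0) + c (U b\<^sub>0)"
      using size by (intro absorb U(1) A(2)) simp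
    moreover have "c (U b\<^sub>0) \<le> (\<Sum>b\<in>A. c (U b))"
      using member_le_sum[of b\<^sub>0 A "\<lambda>b. c (U b)"] A by simp
    ultimately show ?thesis
      using cut U0 by linarith
  qed
qed

text \<open>
  Only block \<open>b\<^sub>0\<close> may be split. If one block \<open>a\<^sub>1\<close> of the second colour is full and another one \<open>a\<^sub>2\<close>
  is empty, each unsplit block of the first colour disagrees with one of the two, and a split \<open>b\<^sub>0\<close>
  replaces its possibly missing mismatch by an inner boundary edge. Otherwise the second
  colour is entirely empty or, up to complements, so.
\<close>
lemma family_cut_one_split:
  assumes A: "finite A" "b\<^sub>0 \<in> A"
    and compl: "\<And>Y. Y \<subseteq> A \<Longrightarrow> c (A - Y) = c Y"
    and pos: "\<And>Y. Y \<subseteq> A \<Longrightarrow> Y \<noteq> {} \<Longrightarrow> Y \<noteq> A \<Longrightarrow> 1 \<le> c Y"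
    and absorb: "\<And>Y. Y \<subseteq> A \<Longrightarrow> 2 \<le> card Y \<Longrightarrow> card A \<le> card Y + c Y"
    and U: "\<And>b. b \<in> A \<Longrightarrow> U b \<subseteq> A" "\<And>b. b \<in> A \<Longrightarrow> b \<noteq> b\<^sub>0 \<Longrightarrow> U b = {} \<or> U b = A"
    and W: "\<And>a. a \<in> A \<Longrightarrow> W a = {} \<or> W a = A"
    and size: "2 \<le> (\<Sum>b\<in>A. card (U b)) + (\<Sum>a\<in>A. card (W a))"
      "2 \<le> (\<Sum>b\<in>A. card (A - U b)) + (\<Sum>a\<in>A. card (A - W a))"
  shows "card A \<le> family_cut c A U W"
proof (cases "(\<forall>a\<in>A. W a = {}) \<or> (\<forall>a\<in>A. W a = A)")
  case True
  then show ?thesis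
  proof
    assume "\<forall>a\<in>A. W a = {}"
    then show ?thesis
      using family_cut_empty[OF A, of c U W] absorb U size(1) by simp
  next
    assume full: "\<forall>a\<in>A. W a = A"
    have "card A \<le> family_cut c A (\<lambda>b. A - U b) (\<lambda>a. A - W a)"
      by (rule family_cut_empty[OF A absorb]) (use U full size(2) in auto)
    moreover have "W a \<subseteq> A" if "a \<in> A" for a
      using full that by simp
    ultimately show ?thesis
      using family_cut_Compl[of A c U W] compl U(1) by simp
  qed
next
  case False
  then obtain a\<^sub>1 a\<^sub>2 where a: "a\<^sub>1 \<in> A" "W a\<^sub>1 = A" "a\<^sub>2 \<in> A" "W a\<^sub>2 = {}"
    using W by metis
  let ?M = "{(a, b) \<in> A \<times> A. (a \<in> U b) \<noteq> (b \<in> W a)}"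
  have finM: "finite ?M"
    using A(1) by (auto intro: finite_subset[of _ "A \<times> A"])
  have column: "b \<in> snd ` ?M" if "b \<in> A" "U b = {} \<or> U b = A" for b
  proof -
    have "(a\<^sub>1, b) \<in> ?M \<or> (a\<^sub>2, b) \<in> ?M"
      using that a by auto
    then show ?thesis
      by force
  qed
  have M: "card B \<le> card ?M" if "B \<subseteq> snd ` ?M" for B
    using card_mono[OF finite_imageI[OF finM] that] card_image_le[OF finM, of snd] by linarith
  show ?thesis
  proof (cases "U b\<^sub>0 = {} \<or> U b\<^sub>0 = A")
    case True
    then have "card A \<le> card ?M"
      using column U(2) by (intro M) blast
    then show ?thesis
      by (simp add: family_cut_def)
  next
    case False
    have "card (A - {b\<^sub>0}) \<le> card ?M"
      using column U(2) by (intro M) blast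
    moreover have "1 \<le> c (U b\<^sub>0)"
      using pos U(1) A(2) False by simp
    moreover have "c (U b\<^sub>0) \<le> (\<Sum>b\<in>A. c (U b))"
      using member_le_sum[of b\<^sub>0 A "\<lambda>b. c (U b)"] A by simp
    ultimately show ?thesis
      using A by (simp add: family_cut_def)
  qed
qed

lemma sum_two_le:
  fixes g :: "'a \<Rightarrow> nat"
  assumes "finite A" "x \<in> A" "y \<in> A" "x \<noteq> y"
  shows "g x + g y \<le> sum g A"
  using sum_mono2[of A "{x, y}" g] assms by simp

text \<open>
  Two split blocks of any colours cost \<open>2 (|A| / 2)\<close>. A smaller cut therefore splits at most one
  block, and after exchanging the colours if necessary that block has the first colour.
\<close>
lemma family_cut_ge:
  assumes A: "finite A"
    and compl: "\<And>Y. Y \<subseteq> A \<Longrightarrow> c (A - Y) = c Y"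
    and half: "\<And>Y. Y \<subseteq> A \<Longrightarrow> Y \<noteq> {} \<Longrightarrow> Y \<noteq> A \<Longrightarrow> card A \<le> 2 * c Y"
    and absorb: "\<And>Y. Y \<subseteq> A \<Longrightarrow> 2 \<le> card Y \<Longrightarrow> card A \<le> card Y + c Y"
    and sub: "\<And>x. x \<in> A \<Longrightarrow> U x \<subseteq> A" "\<And>x. x \<in> A \<Longrightarrow> W x \<subseteq> A"
    and size: "2 \<le> (\<Sum>b\<in>A. card (U b)) + (\<Sum>a\<in>A. card (W a))"
      "2 \<le> (\<Sum>b\<in>A. card (A - U b)) + (\<Sum>a\<in>A. card (A - W a))"
  shows "card A \<le> family_cut c A U W"
proof -
  let ?split = "\<lambda>Y. Y \<noteq> {} \<and> Y \<noteq> A"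
  have pos: "1 \<le> c Y" if "Y \<subseteq> A" "Y \<noteq> {}" "Y \<noteq> A" for Y
  proof -
    have "0 < card A"
      using that A by (auto simp: card_gt_0_iff)
    then show ?thesis
      using half[OF that] by linarith
  qed
  show ?thesis
  proof (rule ccontr)
    assume "\<not> card A \<le> family_cut c A U W"
    then have small: "(\<Sum>b\<in>A. c (U b)) + (\<Sum>a\<in>A. c (W a)) < card A"
      by (simp add: family_cut_def)
    have unique: "\<exists>b\<in>A. \<forall>x\<in>A. x \<noteq> b \<longrightarrow> \<not> ?split (V x)"
      if V: "\<And>x. x \<in> A \<Longrightarrow> V x \<subseteq> A" and less: "(\<Sum>b\<in>A. c (V b)) < card A" for V
    proof (rule ccontr)
      assume none: "\<not> ?thesis"
      obtain b where "b \<in> A"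
        using less by (cases "A = {}") auto
      then obtain x where x: "x \<in> A" "?split (V x)"
        using none by blast
      then obtain y where y: "y \<in> A" "?split (V y)" "x \<noteq> y"
        using none by blast
      have "card A \<le> 2 * c (V x)" "card A \<le> 2 * c (V y)"
        using half V x y by simp_all
      then show False
        using sum_two_le[OF A x(1) y(1,3), of "\<lambda>b. c (V b)"] less by linarith
    qed
    obtain b\<^sub>U where bU: "b\<^sub>U \<in> A" "\<forall>x\<in>A. x \<noteq> b\<^sub>U \<longrightarrow> \<not> ?split (U x)"
      using unique[of U] sub(1) small by auto
    obtain b\<^sub>W where bW: "b\<^sub>W \<in> A" "\<forall>x\<in>A. x \<noteq> b\<^sub>W \<longrightarrow> \<not> ?split (W x)"
      using unique[of W] sub(2) small by auto
    have "False" if xy: "x \<in> A" "?split (U x)" "y \<in> A" "?split (W y)" for x y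
    proof -
      have "c (U x) \<le> (\<Sum>b\<in>A. c (U b))" "c (W y) \<le> (\<Sum>a\<in>A. c (W a))"
        using A xy member_le_sum[of x A "\<lambda>b. c (U b)"] member_le_sum[of y A "\<lambda>b. c (W b)"]
        by simp_all
      moreover have "card A \<le> 2 * c (U x)" "card A \<le> 2 * c (W y)"
        using xy sub half by simp_all
      ultimately show False
        using small by linarith
    qed
    then consider "\<forall>x\<in>A. \<not> ?split (W x)" | "\<forall>x\<in>A. \<not> ?split (U x)"
      by blast
    then have "card A \<le> family_cut c A U W"
    proof cases
      case 1
      show ?thesis
        by (rule family_cut_one_split[OF A bU(1) compl pos absorb]) (use 1 bU sub size in auto)
    next
      case 2
      have "card A \<le> family_cut c A W U"
        by (rule family_cut_one_split[OF A bW(1) compl pos absorb]) (use 2 bW sub size in auto)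
      then show ?thesis
        by (simp add: family_cut_swap)
    qed
    then show False
      using \<open>\<not> card A \<le> family_cut c A U W\<close> by blast
  qed
qed

section \<open>The wreath product with the group of order two\<close>

text \<open>
  The elements are triples \<open>(e, a, b)\<close> in which \<open>e\<close> tells whether the coordinates of the right factor are
  exchanged before multiplication. Multiplying \<open>(e, a, b)\<close> on the right by an element \<open>(False, s, \<one>)\<close>
  thus changes \<open>a\<close> for \<open>e = False\<close> and \<open>b\<close> for \<open>e = True\<close>, whereas \<open>(True, \<one>, \<one>)\<close> flips \<open>e\<close>
  and leaves \<open>a\<close> and \<open>b\<close> unchanged. So \<open>e\<close> is the colour of a block, a block is fixed by \<open>e\<close> and the
  coordinate that does not change, and the flip is the matching.
\<close>
definition swap_wreath :: "('a, 'b) monoid_scheme \<Rightarrow> (bool \<times> 'a \<times> 'a) monoid" where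
  "swap_wreath G =
     \<lparr>carrier = UNIV \<times> carrier G \<times> carrier G,
      monoid.mult = (\<lambda>(e, a, b) (e', a', b').
        (e \<noteq> e', if e then (a \<otimes>\<^bsub>G\<^esub> b', b \<otimes>\<^bsub>G\<^esub> a') else (a \<otimes>\<^bsub>G\<^esub> a', b \<otimes>\<^bsub>G\<^esub> b'))),
      one = (False, \<one>\<^bsub>G\<^esub>, \<one>\<^bsub>G\<^esub>)\<rparr>"

definition wreath_generators :: "('a, 'b) monoid_scheme \<Rightarrow> 'a set \<Rightarrow> (bool \<times> 'a \<times> 'a) set" where
  "wreath_generators G S = insert (True, \<one>\<^bsub>G\<^esub>, \<one>\<^bsub>G\<^esub>) ((\<lambda>s. (False, s, \<one>\<^bsub>G\<^esub>)) ` S)"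

lemma carrier_swap_wreath [simp]: "carrier (swap_wreath G) = UNIV \<times> carrier G \<times> carrier G"
  by (simp add: swap_wreath_def)

lemma card_swap_wreath: "card (carrier (swap_wreath G)) = 2 * card (carrier G) * card (carrier G)"
  by (simp add: card_cartesian_product card_UNIV_bool)

context group
begin

lemma group_swap_wreath: "group (swap_wreath G)"
proof (rule groupI)
  fix x assume "x \<in> carrier (swap_wreath G)"
  then obtain e a b where x: "x = (e, a, b)" "a \<in> carrier G" "b \<in> carrier G"
    by auto
  show "\<exists>y\<in>carrier (swap_wreath G). y \<otimes>\<^bsub>swap_wreath G\<^esub> x = \<one>\<^bsub>swap_wreath G\<^esub>"
    by (rule bexI[of _ "if e then (True, inv b, inv a) else (False, inv a, inv b)"])
      (use x in \<open>auto simp: swap_wreath_def\<close>)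
qed (auto simp: swap_wreath_def m_assoc split: if_splits)

lemma inv_swap_wreath:
  assumes "a \<in> carrier G" "b \<in> carrier G"
  shows "inv\<^bsub>swap_wreath G\<^esub> (e, a, b) = (if e then (True, inv b, inv a) else (False, inv a, inv b))"
  by (rule group.inv_equality[OF group_swap_wreath])
    (use assms in \<open>auto simp: swap_wreath_def\<close>)

lemma inv_mult_eq_one_iff:
  assumes "a \<in> carrier G" "b \<in> carrier G"
  shows "inv a \<otimes> b = \<one> \<longleftrightarrow> a = b"
  using assms inv_solve_left'[of \<one> a b] by auto

lemma swap_wreath_adjacency:
  assumes "a \<in> carrier G" "b \<in> carrier G" "a' \<in> carrier G" "b' \<in> carrier G"
  shows "inv\<^bsub>swap_wreath G\<^esub> (e, a, b) \<otimes>\<^bsub>swap_wreath G\<^esub> (e', a', b') \<in> wreath_generators G S \<longleftrightarrow>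
    (if e \<noteq> e' then a = a' \<and> b = b'
     else if e then a = a' \<and> inv b \<otimes> b' \<in> S
     else b = b' \<and> inv a \<otimes> a' \<in> S)"
  unfolding inv_swap_wreath[OF assms(1,2)]
  using assms by (auto simp: swap_wreath_def wreath_generators_def inv_mult_eq_one_iff)

lemma cayley_set_wreath_generators:
  assumes S: "cayley_set G S"
  shows "cayley_set (swap_wreath G) (wreath_generators G S)"
proof -
  have S': "S \<subseteq> carrier G" "\<one> \<notin> S" "S = (\<lambda>s. inv s) ` S"
    using S by (auto simp: cayley_set_def SET_INV_def)
  have "(\<lambda>x. inv\<^bsub>swap_wreath G\<^esub> x) ` (\<lambda>s. (False, s, \<one>)) ` S = (\<lambda>s. (False, s, \<one>)) ` (\<lambda>s. inv s) ` S"
    unfolding image_image by (intro image_cong refl) (use S'(1) in \<open>auto simp: inv_swap_wreath\<close>)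
  then have "(\<lambda>x. inv\<^bsub>swap_wreath G\<^esub> x) ` wreath_generators G S = wreath_generators G S"
    unfolding wreath_generators_def using S'(3) by (simp add: inv_swap_wreath)
  moreover have "\<one>\<^bsub>swap_wreath G\<^esub> \<notin> wreath_generators G S"
    using S'(2) by (auto simp: swap_wreath_def wreath_generators_def)
  moreover have "wreath_generators G S \<subseteq> carrier (swap_wreath G)"
    using S'(1) by (auto simp: wreath_generators_def)
  ultimately show ?thesis
    by (auto simp: cayley_set_def SET_INV_def)
qed

lemma card_wreath_generators: "finite S \<Longrightarrow> card (wreath_generators G S) = card S + 1"
  by (subst wreath_generators_def, subst card_insert_disjoint)
    (auto simp: card_image inj_on_def)

text \<open>
  The arcs leaving \<open>C\<close> fall into those inside blocks of the first colour, those inside blocks of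
  the second colour, and the matching edges whose ends disagree.
\<close>
lemma card_boundary_arcs_wreath:
  assumes fin: "finite (carrier G)" and C: "C \<subseteq> carrier (swap_wreath G)"
  shows "card (boundary_arcs (swap_wreath G) (wreath_generators G S) C) =
    family_cut (\<lambda>Y. card (boundary_arcs G S Y)) (carrier G)
      (\<lambda>b. {a \<in> carrier G. (False, a, b) \<in> C}) (\<lambda>a. {b \<in> carrier G. (True, a, b) \<in> C})"
    (is "_ = family_cut ?c ?A ?U ?W")
proof -
  let ?M = "{(a, b) \<in> ?A \<times> ?A. (a \<in> ?U b) \<noteq> (b \<in> ?W a)}"
  let ?f = "\<lambda>(b, a, a'). ((False, a, b), (False, a', b))"
  let ?g = "\<lambda>(a, b, b'). ((True, a, b), (True, a, b'))"
  \<comment> \<open>a mismatched pair is oriented so that the arc starts at the end in \<open>C\<close>\<close>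
  let ?h = "\<lambda>(a, b). (((False, a, b) \<notin> C, a, b), ((False, a, b) \<in> C, a, b))"
  let ?F = "?f ` (SIGMA b:?A. boundary_arcs G S (?U b))"
  let ?G = "?g ` (SIGMA a:?A. boundary_arcs G S (?W a))"
  let ?H = "?h ` ?M"
  define B where "B = boundary_arcs (swap_wreath G) (wreath_generators G S) C"
  have arc: "((e, a, b), (e', a', b')) \<in> B \<longleftrightarrow>
      a \<in> ?A \<and> b \<in> ?A \<and> a' \<in> ?A \<and> b' \<in> ?A \<and> (e, a, b) \<in> C \<and> (e', a', b') \<notin> C \<and>
      (if e \<noteq> e' then a = a' \<and> b = b'
       else if e then a = a' \<and> inv b \<otimes> b' \<in> S
       else b = b' \<and> inv a \<otimes> a' \<in> S)" for e a b e' a' b'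
    using C swap_wreath_adjacency[of a b a' b' e e' S] unfolding B_def boundary_arcs_def by auto
  have "B = ?F \<union> ?G \<union> ?H"
  proof (intro equalityI subrelI)
    fix x y assume xy: "(x, y) \<in> B"
    obtain e a b e' a' b' where [simp]: "x = (e, a, b)" "y = (e', a', b')"
      by (cases x, cases y)
    have *: "a \<in> ?A \<and> b \<in> ?A \<and> a' \<in> ?A \<and> b' \<in> ?A \<and> (e, a, b) \<in> C \<and> (e', a', b') \<notin> C \<and>
      (if e \<noteq> e' then a = a' \<and> b = b'
       else if e then a = a' \<and> inv b \<otimes> b' \<in> S
       else b = b' \<and> inv a \<otimes> a' \<in> S)"
      using xy arc by simp
    consider "e \<noteq> e'" | "e" "e'" | "\<not> e" "\<not> e'"
      by blast
    then show "(x, y) \<in> ?F \<union> ?G \<union> ?H"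
    proof cases
      case 1
      then have "(a, b) \<in> ?M" "(x, y) = ?h (a, b)"
        using * by (cases e; auto)+
      then show ?thesis
        by blast
    next
      case 2
      then have "(a, b, b') \<in> (SIGMA a:?A. boundary_arcs G S (?W a))" "(x, y) = ?g (a, b, b')"
        using * by (auto simp: boundary_arcs_def)
      then show ?thesis
        by blast
    next
      case 3
      then have "(b, a, a') \<in> (SIGMA b:?A. boundary_arcs G S (?U b))" "(x, y) = ?f (b, a, a')"
        using * by (auto simp: boundary_arcs_def)
      then show ?thesis
        by blast
    qed
  next
    fix x y assume "(x, y) \<in> ?F \<union> ?G \<union> ?H"
    then consider "(x, y) \<in> ?F" | "(x, y) \<in> ?G" | "(x, y) \<in> ?H"
      by blast
    then show "(x, y) \<in> B"
    proof cases
      case 3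
      then obtain a b where ab: "(a, b) \<in> ?M" "(x, y) = ?h (a, b)"
        by blast
      then show ?thesis
        by (cases "(False, a, b) \<in> C") (auto simp: arc)
    qed (auto simp: arc boundary_arcs_def)
  qed
  moreover have "card (?F \<union> ?G \<union> ?H) = card ?F + card ?G + card ?H"
  proof -
    have fins: "finite (boundary_arcs G S (?U x))" "finite (boundary_arcs G S (?W x))" for x
      using fin by (auto intro!: finite_boundary_arcs)
    have "finite ?M"
      using fin by (auto intro: finite_subset[of _ "?A \<times> ?A"])
    then have "finite ?F" "finite ?G" "finite ?H"
      using fin fins by blast+
    moreover have "?F \<inter> ?G = {}" "(?F \<union> ?G) \<inter> ?H = {}"
      by auto
    ultimately show ?thesis
      by (simp add: card_Un_disjoint)
  qed
  moreover have "card ?F = (\<Sum>b\<in>?A. ?c (?U b))"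
  proof -
    have "card ?F = card (SIGMA b:?A. boundary_arcs G S (?U b))"
      by (rule card_image) (auto simp: inj_on_def)
    also have "\<dots> = (\<Sum>b\<in>?A. ?c (?U b))"
      using fin by (intro card_SigmaI) (auto intro!: finite_boundary_arcs)
    finally show ?thesis .
  qed
  moreover have "card ?G = (\<Sum>a\<in>?A. ?c (?W a))"
  proof -
    have "card ?G = card (SIGMA a:?A. boundary_arcs G S (?W a))"
      by (rule card_image) (auto simp: inj_on_def)
    also have "\<dots> = (\<Sum>a\<in>?A. ?c (?W a))"
      using fin by (intro card_SigmaI) (auto intro!: finite_boundary_arcs)
    finally show ?thesis .
  qed
  moreover have "card ?H = card ?M"
    by (rule card_image) (auto simp: inj_on_def)
  ultimately show ?thesis
    by (simp add: family_cut_def B_def)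
qed

end

context group
begin

lemma card_swap_wreath_subset:
  assumes fin: "finite (carrier G)" and C: "C \<subseteq> carrier (swap_wreath G)"
  shows "card C = (\<Sum>b\<in>carrier G. card {a \<in> carrier G. (False, a, b) \<in> C})
    + (\<Sum>a\<in>carrier G. card {b \<in> carrier G. (True, a, b) \<in> C})"
    (is "_ = (\<Sum>b\<in>?A. card (?U b)) + (\<Sum>a\<in>?A. card (?W a))")
proof -
  let ?F = "(\<lambda>(b, a). (False, a, b)) ` (SIGMA b:?A. ?U b)"
  let ?T = "(\<lambda>(a, b). (True, a, b)) ` (SIGMA a:?A. ?W a)"
  have "x \<in> ?F \<union> ?T" if "x \<in> C" for x
  proof -
    obtain e a b where x: "x = (e, a, b)"
      by (cases x)
    then have "a \<in> ?A" "b \<in> ?A"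
      using C that by auto
    then show ?thesis
      using that x by (cases e) force+
  qed
  then have "C = ?F \<union> ?T"
    by auto
  moreover have "card (?F \<union> ?T) = card ?F + card ?T"
    using fin by (intro card_Un_disjoint) auto
  moreover have "card ?F = (\<Sum>b\<in>?A. card (?U b))"
    using fin by (subst card_image) (auto simp: inj_on_def)
  moreover have "card ?T = (\<Sum>a\<in>?A. card (?W a))"
    using fin by (subst card_image) (auto simp: inj_on_def)
  ultimately show ?thesis
    by presburger
qed

lemma card_boundary_arcs_wreath_ge:
  assumes fin: "finite (carrier G)" and S: "cayley_set G S"
    and dense: "card (carrier G) \<le> 2 * card S"
    and C: "C \<subseteq> carrier (swap_wreath G)"
      "2 \<le> card C" "2 \<le> card (carrier (swap_wreath G) - C)"
  shows "card (carrier G) \<le> card (boundary_arcs (swap_wreath G) (wreath_generators G S) C)"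
proof -
  let ?A = "carrier G"
  let ?U = "\<lambda>C b. {a \<in> ?A. (False, a, b) \<in> C}" and ?W = "\<lambda>C a. {b \<in> ?A. (True, a, b) \<in> C}"
  let ?D = "carrier (swap_wreath G) - C"
  have "(\<Sum>b\<in>?A. card (?U ?D b)) = (\<Sum>b\<in>?A. card (?A - ?U C b))"
    by (intro sum.cong refl arg_cong[where f = card]) auto
  moreover have "(\<Sum>a\<in>?A. card (?W ?D a)) = (\<Sum>a\<in>?A. card (?A - ?W C a))"
    by (intro sum.cong refl arg_cong[where f = card]) auto
  ultimately have size: "2 \<le> (\<Sum>b\<in>?A. card (?A - ?U C b)) + (\<Sum>a\<in>?A. card (?A - ?W C a))"
    using card_swap_wreath_subset[OF fin, of ?D] C(3) by simp
  have "card ?A \<le> family_cut (\<lambda>Y. card (boundary_arcs G S Y)) ?A (?U C) (?W C)"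
  proof (rule family_cut_ge[OF fin])
    fix Y assume Y: "Y \<subseteq> ?A"
    show "card (boundary_arcs G S (?A - Y)) = card (boundary_arcs G S Y)"
      by (rule card_boundary_arcs_Compl[OF S Y])
    show "card ?A \<le> 2 * card (boundary_arcs G S Y)" if "Y \<noteq> {}" "Y \<noteq> ?A"
      using card_boundary_arcs_dense(1)[OF fin S dense Y that] dense by linarith
    show "card ?A \<le> card Y + card (boundary_arcs G S Y)" if "2 \<le> card Y"
      by (rule card_boundary_arcs_dense(2)[OF fin S dense Y that])
  next
    show "2 \<le> (\<Sum>b\<in>?A. card (?U C b)) + (\<Sum>a\<in>?A. card (?W C a))"
      using card_swap_wreath_subset[OF fin C(1)] C(2) by simp
  qed (use size in auto)
  then show ?thesis
    using card_boundary_arcs_wreath[OF fin C(1)] by simp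
qed

text \<open>The block of the first factor has no inner boundary, and each of its vertices is mismatched.\<close>
lemma card_boundary_arcs_wreath_block:
  assumes fin: "finite (carrier G)"
  shows "card (boundary_arcs (swap_wreath G) (wreath_generators G S)
    ((\<lambda>a. (False, a, \<one>)) ` carrier G)) = card (carrier G)"
proof -
  let ?A = "carrier G" and ?C = "(\<lambda>a. (False, a, \<one>)) ` carrier G"
  let ?U = "\<lambda>b. {a \<in> ?A. (False, a, b) \<in> ?C}" and ?W = "\<lambda>a. {b \<in> ?A. (True, a, b) \<in> ?C}"
  have none: "boundary_arcs G S Y = {}" if "Y = {} \<or> Y = ?A" for Y
    using that by (auto simp: boundary_arcs_def)
  have U: "?U b = {} \<or> ?U b = ?A" and W: "?W a = {} \<or> ?W a = ?A" for a b
    by auto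
  have "{(a, b) \<in> ?A \<times> ?A. (a \<in> ?U b) \<noteq> (b \<in> ?W a)} = (\<lambda>a. (a, \<one>)) ` ?A"
    by auto
  then have "card {(a, b) \<in> ?A \<times> ?A. (a \<in> ?U b) \<noteq> (b \<in> ?W a)} = card ?A"
    by (simp add: card_image inj_on_def)
  moreover have "card (boundary_arcs G S (?U b)) = 0" "card (boundary_arcs G S (?W a)) = 0" for a b
    by (simp_all only: none[OF U] none[OF W] card.empty)
  ultimately have "family_cut (\<lambda>Y. card (boundary_arcs G S Y)) ?A ?U ?W = card ?A"
    by (simp only: family_cut_def sum.neutral_const add_0)
  then show ?thesis
    using card_boundary_arcs_wreath[OF fin, of ?C S] by (simp add: image_subset_iff)
qed

text \<open>
  Sets with a single element, and their complements, have a boundary of \<open>|S|\<close> arcs, so that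
  the remaining sets decide connectedness.
\<close>
lemma connected_cayley_graphI:
  assumes fin: "finite (carrier G)" and S: "cayley_set G S" "S \<noteq> {}"
    and pos: "\<And>C. C \<subseteq> carrier G \<Longrightarrow> 2 \<le> card C \<Longrightarrow> 2 \<le> card (carrier G - C) \<Longrightarrow>
      boundary_arcs G S C \<noteq> {}"
  shows "connected_graph (cayley_graph G S)"
proof (rule ccontr)
  let ?\<Gamma> = "cayley_graph G S"
  assume "\<not> connected_graph ?\<Gamma>"
  moreover have "verts ?\<Gamma> \<noteq> {}"
    using one_closed by (auto simp: cayley_graph_def)
  ultimately obtain C where C: "C \<subset> verts ?\<Gamma>" "C \<noteq> {}" "edge_boundary ?\<Gamma> C = {}"
    using disconnected_graph_boundaryE[OF simple_graph_cayley_graph[OF is_group fin S(1)]] by metis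
  then have sub: "C \<subseteq> carrier G" and ne: "carrier G - C \<noteq> {}"
    by (auto simp: cayley_graph_def)
  have zero: "card (boundary_arcs G S C) = 0"
    using card_edge_boundary_cayley_graph[OF S(1) sub] C(3) by simp
  have S': "S \<subseteq> carrier G" "\<one> \<notin> S" "0 < card S"
    using S fin finite_subset[of S] by (auto simp: cayley_set_def card_gt_0_iff)
  have single: "0 < card (boundary_arcs G S D)" if "D \<subseteq> carrier G" "card D = 1" for D
    using card_boundary_arcs_ge_degree[OF fin S'(1,2) that(1)] that(2) S'(3) by simp
  have "card C \<noteq> 1"
    using single[OF sub] zero by auto
  moreover have "card (carrier G - C) \<noteq> 1"
    using single[of "carrier G - C"] card_boundary_arcs_Compl[OF S(1) sub] zero by auto
  moreover have "card C \<noteq> 0" "card (carrier G - C) \<noteq> 0"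
    using C(2) ne fin finite_subset[OF sub fin] by simp_all
  ultimately have "boundary_arcs G S C \<noteq> {}"
    by (intro pos sub) linarith+
  then show False
    using zero finite_boundary_arcs[OF fin sub] by simp
qed

text \<open>
  The block of the first factor attains the bound: right multiplication by a generator
  \<open>(False, s, \<one>)\<close> moves each vertex to a neighbour in its own block, so no vertex becomes isolated
  when the boundary of this block is deleted. Density forces \<open>S\<close> to be nonempty, which provides \<open>s\<close>.
\<close>
lemma restricted_edge_connectivity_wreath:
  fixes \<Gamma> :: "('v, 'c) monoid_scheme"
  assumes fin: "finite (carrier G)" and S: "cayley_set G S"
    and dense: "card (carrier G) \<le> 2 * card S"
    and \<Gamma>: "group \<Gamma>" "\<phi> \<in> iso (swap_wreath G) \<Gamma>"
  defines "R \<equiv> \<phi> ` wreath_generators G S"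
  shows "cayley_set \<Gamma> R" "connected_graph (cayley_graph \<Gamma> R)"
    "regular_graph (cayley_graph \<Gamma> R) (card S + 1)"
    "restricted_edge_connectivity (cayley_graph \<Gamma> R) = card (carrier G)"
proof -
  interpret \<Gamma>: group \<Gamma>
    by fact
  let ?P = "swap_wreath G" and ?Q = "wreath_generators G S"
  let ?X = "cayley_graph \<Gamma> R"
  have P: "group ?P"
    by (rule group_swap_wreath)
  have Q: "cayley_set ?P ?Q"
    by (rule cayley_set_wreath_generators[OF S])
  then have Qsub: "?Q \<subseteq> carrier ?P"
    by (simp add: cayley_set_def)
  have inj: "inj_on \<phi> (carrier ?P)" and surj: "\<phi> ` carrier ?P = carrier \<Gamma>"
    and hom: "\<phi> \<in> hom ?P \<Gamma>"
    using \<Gamma>(2) by (auto simp: iso_def bij_betw_def)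
  have fin\<Gamma>: "finite (carrier \<Gamma>)"
    unfolding surj[symmetric] using fin by simp
  show R: "cayley_set \<Gamma> R"
    unfolding R_def by (rule cayley_set_iso[OF P \<Gamma> Q])
  have Ssub: "S \<subseteq> carrier G"
    using S by (simp add: cayley_set_def)
  have finS: "finite S"
    using Ssub fin finite_subset by blast
  have "card R = card S + 1"
    unfolding R_def using card_image[OF inj_on_subset[OF inj Qsub]] card_wreath_generators[OF finS]
    by simp
  then show "regular_graph ?X (card S + 1)"
    using \<Gamma>.regular_cayley_graph[OF R] by simp
  have pos: "0 < card (carrier G)"
    using fin by (auto simp: card_gt_0_iff)
  have lower: "card (carrier G) \<le> card (boundary_arcs \<Gamma> R C)"
    if C: "C \<subseteq> carrier \<Gamma>" "2 \<le> card C" "2 \<le> card (carrier \<Gamma> - C)" for C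
  proof -
    define D where "D = {x \<in> carrier ?P. \<phi> x \<in> C}"
    have D: "D \<subseteq> carrier ?P" "\<phi> ` D = C"
      using C(1) surj by (auto simp: D_def)
    have "\<phi> ` (carrier ?P - D) = carrier \<Gamma> - C"
      using inj_on_image_set_diff[OF inj, of "carrier ?P" D] D surj by auto
    then have "card (carrier ?P - D) = card (carrier \<Gamma> - C)"
      using card_image[OF inj_on_subset[OF inj, of "carrier ?P - D"]] by auto
    moreover have "card D = card C"
      using card_image[OF inj_on_subset[OF inj D(1)]] D(2) by simp
    ultimately have "card (carrier G) \<le> card (boundary_arcs ?P ?Q D)"
      using C(2,3) by (intro card_boundary_arcs_wreath_ge[OF fin S dense D(1)]) simp_all
    then show ?thesis
      using card_boundary_arcs_iso[OF P \<Gamma> Qsub D(1)] D(2) by (simp add: R_def)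
  qed
  show "connected_graph ?X"
  proof (rule \<Gamma>.connected_cayley_graphI[OF fin\<Gamma> R])
    show "R \<noteq> {}"
      by (simp add: R_def wreath_generators_def)
    show "boundary_arcs \<Gamma> R C \<noteq> {}"
      if "C \<subseteq> carrier \<Gamma>" "2 \<le> card C" "2 \<le> card (carrier \<Gamma> - C)" for C
      using lower[OF that] pos by auto
  qed
  obtain s where s: "s \<in> S"
    using pos dense by fastforce
  let ?B = "(\<lambda>a. (False, a, \<one>)) ` carrier G"
  let ?t = "\<phi> (False, s, \<one>)"
  have B: "?B \<subseteq> carrier ?P"
    by auto
  have verts: "verts ?X = carrier \<Gamma>"
    by (simp add: cayley_graph_def)
  show "restricted_edge_connectivity ?X = card (carrier G)"
  proof (rule restricted_edge_connectivity_eqI[where C = "\<phi> ` ?B"])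
    show "simple_graph ?X"
      by (rule simple_graph_cayley_graph[OF \<Gamma>(1) fin\<Gamma> R])
    have "\<phi> (True, \<one>, \<one>) \<notin> \<phi> ` ?B"
      by (subst inj_on_image_mem_iff[OF inj _ B]) auto
    then show "\<phi> ` ?B \<subset> verts ?X"
      unfolding verts surj[symmetric] using B by (intro psubsetI image_mono) auto
    show "\<phi> ` ?B \<noteq> {}"
      by auto
    show "card (edge_boundary ?X (\<phi> ` ?B)) = card (carrier G)"
    proof -
      have "\<phi> ` ?B \<subseteq> carrier \<Gamma>"
        using B surj by blast
      then have "card (edge_boundary ?X (\<phi> ` ?B)) = card (boundary_arcs \<Gamma> R (\<phi> ` ?B))"
        by (rule \<Gamma>.card_edge_boundary_cayley_graph[OF R])
      also have "\<dots> = card (boundary_arcs ?P ?Q ?B)"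
        unfolding R_def by (rule card_boundary_arcs_iso[OF P \<Gamma> Qsub B])
      finally show ?thesis
        using card_boundary_arcs_wreath_block[OF fin] by simp
    qed
    show "card (carrier G) \<le> card (edge_boundary ?X C)"
      if C: "C \<subseteq> verts ?X" "2 \<le> card C" "2 \<le> card (verts ?X - C)" for C
      using lower C \<Gamma>.card_edge_boundary_cayley_graph[OF R] by (simp add: verts)
    show "\<exists>w. {v, w} \<in> edges ?X \<and> (v \<in> \<phi> ` ?B \<longleftrightarrow> w \<in> \<phi> ` ?B)" if v: "v \<in> verts ?X" for v
    proof -
      obtain e a b where x: "v = \<phi> (e, a, b)" "a \<in> carrier G" "b \<in> carrier G"
        using v unfolding verts surj[symmetric] by auto
      define y where "y = (e, a, b) \<otimes>\<^bsub>?P\<^esub> (False, s, \<one>)"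
      have sG: "s \<in> carrier G"
        using s Ssub by blast
      have y: "y = (if e then (True, a, b \<otimes> s) else (False, a \<otimes> s, b))"
        using x sG by (simp add: y_def swap_wreath_def)
      then have yP: "y \<in> carrier ?P" "y \<in> ?B \<longleftrightarrow> (e, a, b) \<in> ?B"
        using x sG by auto
      have side: "v \<in> \<phi> ` ?B \<longleftrightarrow> \<phi> y \<in> \<phi> ` ?B"
        unfolding x(1) using yP x
        by (simp add: inj_on_image_mem_iff[OF inj _ B])
      have t: "?t \<in> R" "?t \<in> carrier \<Gamma>"
        using s R by (auto simp: R_def wreath_generators_def cayley_set_def)
      have vG: "v \<in> carrier \<Gamma>"
        using v verts by simp
      have "\<phi> y = v \<otimes>\<^bsub>\<Gamma>\<^esub> ?t"
        unfolding y_def x(1) using x sG by (intro hom_mult[OF hom]) auto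
      then have "inv\<^bsub>\<Gamma>\<^esub> v \<otimes>\<^bsub>\<Gamma>\<^esub> \<phi> y \<in> R"
        using vG t by (simp flip: \<Gamma>.m_assoc)
      moreover have "\<phi> y \<in> carrier \<Gamma>"
        using yP(1) surj by blast
      ultimately have "{v, \<phi> y} \<in> edges ?X"
        using \<Gamma>.cayley_edge_iff[OF R vG] by blast
      then show ?thesis
        using side by blast
    qed
  qed
qed

end

section \<open>Connection sets in cyclic groups, and the graphs of every odd degree\<close>

text \<open>
  The residues \<open>\<plusminus> 1, \<dots>, \<plusminus> h\<close>, listed by their representatives in \<open>{0..<m}\<close>.
  They are distinct because \<open>2 h < m\<close>.
\<close>
lemma cayley_set_integer_mod_group:
  assumes "2 * h < m"
  shows "cayley_set (integer_mod_group m) ({1..int h} \<union> {int m - int h..<int m})"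
    "card ({1..int h} \<union> {int m - int h..<int m}) = 2 * h"
proof -
  let ?T = "{1..int h} \<union> {int m - int h..<int m}" and ?Z = "integer_mod_group m"
  have T: "?T \<subseteq> carrier ?Z"
    using assms by (auto simp: carrier_integer_mod_group)
  have inv: "inv\<^bsub>?Z\<^esub> x = int m - x" if "x \<in> ?T" for x
  proof -
    have "0 < x" "x < int m"
      using that assms by auto
    moreover have "inv\<^bsub>?Z\<^esub> x = (- x) mod int m"
      using T that by (intro inv_integer_mod_group) blast
    ultimately show ?thesis
      by (simp add: zmod_zminus1_eq_if)
  qed
  have "?T = (\<lambda>x. inv\<^bsub>?Z\<^esub> x) ` ?T"
  proof -
    have "(\<lambda>x. inv\<^bsub>?Z\<^esub> x) ` ?T = (\<lambda>x. int m - x) ` ?T"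
      using inv by (rule image_cong[OF refl])
    also have "\<dots> = ?T"
    proof (intro equalityI subsetI)
      fix x assume x: "x \<in> ?T"
      then have "x = int m - (int m - x)" "int m - x \<in> ?T"
        by auto
      then show "x \<in> (\<lambda>x. int m - x) ` ?T"
        by (rule image_eqI)
    qed auto
    finally show ?thesis
      by simp
  qed
  moreover have "0 \<notin> ?T"
    using assms by auto
  ultimately show "cayley_set ?Z ?T"
    using T by (auto simp: cayley_set_def SET_INV_def)
  show "card ?T = 2 * h"
    using assms by (subst card_Un_disjoint) auto
qed

theorem theorem5p11:
  fixes d s :: nat
  assumes "odd d" and "d \<ge> 5" and "1 \<le> s" and "s \<le> d - 3"
  shows "\<exists>G :: nat graph.
           is_cayley_graph G \<and> connected_graph G \<and> regular_graph G d \<and>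
           restricted_edge_connectivity G = d + s \<and>
           real (d + s) < 1 / 2 * real (card (verts G))"
proof -
  define m where "m = d + s"
  \<comment> \<open>\<open>d\<close> being odd, a symmetric set of \<open>d - 1\<close> nonzero residues can avoid elements of order two\<close>
  define h where "h = (d - 1) div 2"
  have h: "2 * h = d - 1" "2 * h < m" "m \<le> 2 * (2 * h)"
    using assms by (auto simp: h_def m_def elim!: oddE)
  define Z where "Z = integer_mod_group m"
  define T where "T = {1..int h} \<union> {int m - int h..<int m}"
  have T: "cayley_set Z T" "card T = d - 1"
    using cayley_set_integer_mod_group[OF h(2)] h(1) by (simp_all add: Z_def T_def)
  interpret Z: group Z
    by (simp add: Z_def)
  have Z: "finite (carrier Z)" "card (carrier Z) = m"
    using assms by (simp_all add: Z_def carrier_integer_mod_group m_def)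
  let ?f = "to_nat :: bool \<times> int \<times> int \<Rightarrow> nat"
  define \<Gamma> where "\<Gamma> = image_group ?f (swap_wreath Z)"
  have inj: "inj_on ?f (carrier (swap_wreath Z))"
    by simp
  have \<Gamma>: "group \<Gamma>" "?f \<in> iso (swap_wreath Z) \<Gamma>"
    using iso_image_group[OF Z.group_swap_wreath inj] by (simp_all add: \<Gamma>_def)
  have carrier: "carrier \<Gamma> = ?f ` carrier (swap_wreath Z)"
    by (simp add: \<Gamma>_def image_group_def)
  define R where "R = ?f ` wreath_generators Z T"
  have dense: "card (carrier Z) \<le> 2 * card T"
    using Z(2) T(2) h by simp
  note main = Z.restricted_edge_connectivity_wreath[OF Z(1) T(1) dense \<Gamma>, folded R_def]
  have "card (verts (cayley_graph \<Gamma> R)) = 2 * m * m"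
    using card_image[OF inj] carrier card_swap_wreath[of Z] Z(2) by (simp add: cayley_graph_def)
  moreover have "1 < m"
    using assms by (simp add: m_def)
  then have "real m * 1 < real m * real m"
    by (intro mult_strict_left_mono) simp_all
  ultimately have "real m < 1 / 2 * real (card (verts (cayley_graph \<Gamma> R)))"
    by simp
  then have "real (d + s) < 1 / 2 * real (card (verts (cayley_graph \<Gamma> R)))"
    by (simp add: m_def)
  moreover have "finite (carrier \<Gamma>)"
    unfolding carrier using Z(1) by simp
  then have "is_cayley_graph (cayley_graph \<Gamma> R)"
    using \<Gamma>(1) main(1) by (auto simp: is_cayley_graph_def)
  moreover have "card T + 1 = d"
    using T(2) assms by simp
  ultimately show ?thesis
    using main(2-4) Z(2) by (auto simp: m_def)
qed

end
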